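(* Let $F_n$ be the $n\times n$ Fourier matrix and $\omega=e^{2\pi i/n}$. Take the butterfly diagram of the classical Cooley–Tukey FFT for an $n$-dimensional input, which consists of radix-2 operations $[a,b]\mapsto[a+\omega^k b,\,a-\omega^k b]$ (the power $k$ depending on the position of the radix-2 operation in the diagram). Form a quantum circuit on $n$ qubits by replacing each radix-2 operation with a single-qubit phase gate $\mathrm{diag}(1,-\omega^k)$ on the first (top) of the two qubits concerned, followed by the two-qubit gate $RBS(-\pi/4)$ on these two qubits. (1) On two qubits, the phase gate followed by $RBS(-\pi/4)$, restricted to the unary basis $\{|01\rangle,|10\rangle\}$, is exactly the scaled radix-2 operation $$\frac1{\sqrt2}\begin{pmatrix}1&\omega^k\\1&-\omega^k\end{pmatrix}.$$ (2) Consequently the whole circuit (the unary-QFT), restricted to the unary basis and applied to the input vector permuted by the fixed input permutation of the FFT diagram, implements the unitary matrix $F_n/\sqrt n$: for a normalised real vector $x=(x_1,\dots,x_n)$ with Fourier transform $\hat x=\frac1{\sqrt n}F_nx$ (and with the fixed permutation accounted for when loading the input), $$QFT\Big(\sum_i x_i|e_i\rangle\Big)=\sum_i\hat x_i|e_i\rangle .$$ (3) For an $n$-dimensional vector, this requires $n$ qubits, $\log(n)$ depth and $n\log(n)$ gates. (4) The inverse circuit, together with the right permutation of the input data, gives the inverse transform: $IQFT\big(\sum_i\hat x_i|e_i\rangle\big)=\sum_i x_i|e_i\rangle$.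
   Context: On $n$ qubits, $|e_i\rangle=|0\cdots010\cdots0\rangle$ is the computational basis state with a single $1$, on the $i$-th qubit; these $n$ states form the unary basis. $F_n$ is the $n\times n$ matrix with entries $(F_n)_{jk}=\omega^{(j-1)(k-1)}$, $1\le j,k\le n$. $RBS(\theta)$ is the two-qubit gate whose matrix in the ordered basis $|00\rangle,|01\rangle,|10\rangle,|11\rangle$ is $$RBS(\theta)=\begin{pmatrix}1&0&0&0\\0&\cos\theta&\sin\theta&0\\0&-\sin\theta&\cos\theta&0\\0&0&0&1\end{pmatrix}.$$ It preserves Hamming weight. The phase gate on the first qubit has matrix $\mathrm{diag}(1,1,-\omega^k,-\omega^k)$ in the same ordered basis. Gates may act on any pair of qubits required by the butterfly diagram. *)

theory Defs
  imports "Jordan_Normal_Form.Schur_Decomposition"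
begin

section \<open>Quantum states\<close>

text \<open>
  A state of \<open>n\<close> qubits is a vector of dimension \<open>2 ^ n\<close>. Qubits are numbered from 0, starting at
  the right end of a ket: in \<open>|q\<^sub>n\<^sub>-\<^sub>1 \<dots> q\<^sub>1 q\<^sub>0\<rangle>\<close> the value of qubit \<open>i\<close> is bit \<open>i\<close> of the index of the
  basis vector. A list of bits is read from left to right, so \<open>ket [False, True]\<close> is \<open>|01\<rangle>\<close>.
\<close>

definition ket :: "bool list \<Rightarrow> complex vec" where
  "ket bs = unit_vec (2 ^ length bs) (horner_sum of_bool 2 (rev bs))"

definition unary_ket :: "nat \<Rightarrow> nat \<Rightarrow> complex vec" where
  "unary_ket n i = ket (rev (map (\<lambda>q. q = i) [0..<n]))"

text \<open>The state with amplitude \<open>v\<^sub>i\<close> on the unary state whose single 1 is on qubit \<open>\<sigma> i\<close>.\<close>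

definition unary_state :: "nat \<Rightarrow> (nat \<Rightarrow> nat) \<Rightarrow> complex vec \<Rightarrow> complex vec" where
  "unary_state n \<sigma> v =
     finsum_vec TYPE(complex) (2 ^ n) (\<lambda>i. v $ i \<cdot>\<^sub>v unary_ket n (\<sigma> i)) {..<n}"

text \<open>
  \<open>U\<close> maps the \<open>j\<close>-th vector of \<open>bs\<close> to the combination of the vectors of \<open>cs\<close> whose coefficients form
  the \<open>j\<close>-th column of \<open>A\<close>. For \<open>bs = cs\<close> an orthonormal list this says that the span of \<open>bs\<close> is
  invariant under \<open>U\<close> and that the restriction of \<open>U\<close> to it has matrix \<open>A\<close>.
\<close>

definition implements ::
  "complex mat \<Rightarrow> complex vec list \<Rightarrow> complex vec list \<Rightarrow> complex mat \<Rightarrow> bool" where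
  "implements U bs cs A \<longleftrightarrow>
     A \<in> carrier_mat (length cs) (length bs) \<and>
     U * mat_of_cols (dim_col U) bs = mat_of_cols (dim_row U) cs * A"

definition unitary_mat :: "complex mat \<Rightarrow> bool" where
  "unitary_mat A \<longleftrightarrow> square_mat A \<and> inverts_mat A (mat_adjoint A) \<and> inverts_mat (mat_adjoint A) A"


section \<open>Gates and circuits\<close>

text \<open>
  \<open>Phase q z\<close> is \<open>diag(1, z)\<close> on qubit \<open>q\<close>. In \<open>RBS p q \<theta>\<close> the qubit \<open>p\<close> is the first one, i.e.\ the
  left one in the ordered basis \<open>|00\<rangle>, |01\<rangle>, |10\<rangle>, |11\<rangle>\<close>.
\<close>

datatype gate = Phase nat complex | RBS nat nat real

definition phase_mat :: "complex \<Rightarrow> complex mat" where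
  "phase_mat z = mat_of_rows_list 2 [[1, 0], [0, z]]"

definition RBS_mat :: "real \<Rightarrow> complex mat" where
  "RBS_mat \<theta> = mat_of_rows_list 4
     [[1, 0, 0, 0],
      [0, complex_of_real (cos \<theta>), complex_of_real (sin \<theta>), 0],
      [0, - complex_of_real (sin \<theta>), complex_of_real (cos \<theta>), 0],
      [0, 0, 0, 1]]"

text \<open>
  \<open>on_qubits n qs M\<close> is \<open>M\<close> acting on the qubits \<open>qs\<close> (the first one leftmost in the kets that index
  the rows and columns of \<open>M\<close>), tensored with the identity on the remaining ones of \<open>n\<close> qubits.
\<close>

definition local_index :: "nat list \<Rightarrow> nat \<Rightarrow> nat" where
  "local_index qs r = horner_sum of_bool 2 (rev (map (bit r) qs))"

definition on_qubits :: "nat \<Rightarrow> nat list \<Rightarrow> complex mat \<Rightarrow> complex mat" where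
  "on_qubits n qs M = mat (2 ^ n) (2 ^ n) (\<lambda>(r, c).
     if \<forall>i<n. i \<notin> set qs \<longrightarrow> bit r i = bit c i
     then M $$ (local_index qs r, local_index qs c) else 0)"

fun gate_mat :: "nat \<Rightarrow> gate \<Rightarrow> complex mat" where
  "gate_mat n (Phase q z) = on_qubits n [q] (phase_mat z)"
| "gate_mat n (RBS p q \<theta>) = on_qubits n [p, q] (RBS_mat \<theta>)"

fun gate_qubits :: "gate \<Rightarrow> nat set" where
  "gate_qubits (Phase q z) = {q}"
| "gate_qubits (RBS p q \<theta>) = {p, q}"

fun valid_gate :: "nat \<Rightarrow> gate \<Rightarrow> bool" where
  "valid_gate n (Phase q z) \<longleftrightarrow> q < n"
| "valid_gate n (RBS p q \<theta>) \<longleftrightarrow> p < n \<and> q < n \<and> p \<noteq> q"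

text \<open>A circuit is the list of its gates, the gate applied first being the head.\<close>

definition circuit_mat :: "nat \<Rightarrow> gate list \<Rightarrow> complex mat" where
  "circuit_mat n C = fold (\<lambda>g U. gate_mat n g * U) C (1\<^sub>m (2 ^ n))"

fun inverse_gate :: "gate \<Rightarrow> gate" where
  "inverse_gate (Phase q z) = Phase q (inverse z)"
| "inverse_gate (RBS p q \<theta>) = RBS p q (- \<theta>)"

definition inverse_circuit :: "gate list \<Rightarrow> gate list" where
  "inverse_circuit C = rev (map inverse_gate C)"

fun relabel_gate :: "(nat \<Rightarrow> nat) \<Rightarrow> gate \<Rightarrow> gate" where
  "relabel_gate \<sigma> (Phase q z) = Phase (\<sigma> q) z"
| "relabel_gate \<sigma> (RBS p q \<theta>) = RBS (\<sigma> p) (\<sigma> q) \<theta>"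

text \<open>
  Depth of a sequence of operations, each given by the set of qubits it occupies for one time step:
  every operation starts as soon as all its qubits are free.
\<close>

definition schedule :: "nat set \<Rightarrow> (nat \<Rightarrow> nat) \<Rightarrow> nat \<Rightarrow> nat" where
  "schedule Q t = (\<lambda>q. if q \<in> Q then Suc (Max (t ` Q)) else t q)"

definition depth :: "nat set list \<Rightarrow> nat" where
  "depth Qs = Max (insert 0 (fold schedule Qs (\<lambda>_. 0) ` \<Union> (set Qs)))"


section \<open>Fourier matrix and Cooley--Tukey butterfly diagram\<close>

definition omega :: "nat \<Rightarrow> complex" where
  "omega n = exp (2 * of_real pi * \<i> / of_nat n)"

text \<open>Row and column indices start at 0 here.\<close>

definition fourier_mat :: "nat \<Rightarrow> complex mat" where
  "fourier_mat n = mat n n (\<lambda>(j, k). omega n ^ (j * k))"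

abbreviation scaled_fourier_mat :: "nat \<Rightarrow> complex mat" where
  "scaled_fourier_mat n \<equiv> complex_of_real (1 / sqrt (real n)) \<cdot>\<^sub>m fourier_mat n"

definition radix2_mat :: "complex \<Rightarrow> nat \<Rightarrow> complex mat" where
  "radix2_mat \<omega> k = mat_of_rows_list 2 [[1, \<omega> ^ k], [1, - (\<omega> ^ k)]]"

text \<open>
  A triple \<open>(i, j, k)\<close> is the radix-2 operation \<open>[a, b] \<mapsto> [a + \<omega>\<^sup>k b, a - \<omega>\<^sup>k b]\<close> with \<open>a\<close> on wire \<open>i\<close> and
  \<open>b\<close> on wire \<open>j\<close>. \<open>fft_diagram m l s\<close> is the diagram of size \<open>2 ^ m\<close> on the wires from \<open>l\<close> on, for
  the root of unity \<open>\<omega> ^ s\<close>: the transforms of the even-indexed inputs (first half of the wires) and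
  of the odd-indexed inputs (second half) are combined by a column of radix-2 operations.
\<close>

type_synonym butterfly = "nat \<times> nat \<times> nat"

fun fft_diagram :: "nat \<Rightarrow> nat \<Rightarrow> nat \<Rightarrow> butterfly list" where
  "fft_diagram 0 l s = []"
| "fft_diagram (Suc m) l s =
     fft_diagram m l (2 * s) @ fft_diagram m (l + 2 ^ m) (2 * s) @
     map (\<lambda>j. (l + j, l + 2 ^ m + j, j * s)) [0..<2 ^ m]"

fun butterfly_wires :: "butterfly \<Rightarrow> nat set" where
  "butterfly_wires (i, j, k) = {i, j}"

text \<open>
  The input permutation that goes with this diagram (component \<open>i\<close> of the input enters on wire
  \<open>bit_reversal m i\<close>).
\<close>

definition bit_reversal :: "nat \<Rightarrow> nat \<Rightarrow> nat" where
  "bit_reversal m i = horner_sum of_bool 2 (rev (map (bit i) [0..<m]))"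

text \<open>
  With respect to \<open>|01\<rangle>, |10\<rangle>\<close>, in this order, \<open>a\<close> is the amplitude of the excitation of the second
  qubit and \<open>b\<close> that of the first, so the first of the two qubits is the one of wire \<open>j\<close>; in the
  diagram above \<open>i < j\<close>, and it is also the left (top) one in the numbering of the qubits.
\<close>

fun butterfly_gates :: "complex \<Rightarrow> butterfly \<Rightarrow> gate list" where
  "butterfly_gates \<omega> (i, j, k) = [Phase j (- (\<omega> ^ k)), RBS j i (- pi / 4)]"

definition unary_qft :: "nat \<Rightarrow> gate list" where
  "unary_qft m = concat (map (butterfly_gates (omega (2 ^ m))) (fft_diagram m 0 1))"

end

(*
  All gates preserve the span of the unary states, so the circuit is determined by how each gate
  changes the n amplitudes; a phase gate followed by RBS(-pi/4) then is the radix-2 operation divided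
  by sqrt 2. Induction on the recursive diagram (even-indexed inputs, odd-indexed inputs, one column
  of radix-2 operations) shows that the amplitudes undergo the discrete Fourier transform, scaled by
  1/sqrt 2 once per level. The inverse circuit undoes the action on amplitudes gate by gate, and as
  bit reversal is an involution, relabelling the qubits moves it from the output to the input.
*)
theory Submission
  imports Defs
begin

section \<open>Unary states and gates\<close>

text \<open>Amplitudes are a function on qubit numbers, so that a gate becomes a function update.
  \<open>2 ^ i\<close> is the index whose only set bit is \<open>i\<close>, hence at most one
  summand is nonzero; values of \<open>v\<close> from \<open>n\<close> on are ignored.\<close>

definition unary_vec :: "nat \<Rightarrow> (nat \<Rightarrow> complex) \<Rightarrow> complex vec" where
  "unary_vec n v = vec (2 ^ n) (\<lambda>r. \<Sum>i<n. if r = 2 ^ i then v i else 0)"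

lemma dim_unary_vec [simp]: "dim_vec (unary_vec n v) = 2 ^ n"
  by (simp add: unary_vec_def)

lemma unary_vec_carrier [simp]: "unary_vec n v \<in> carrier_vec (2 ^ n)"
  by (rule carrier_vecI) simp

lemma unary_vec_cong: "(\<And>i. i < n \<Longrightarrow> v i = w i) \<Longrightarrow> unary_vec n v = unary_vec n w"
  by (auto simp: unary_vec_def intro!: eq_vecI sum.cong)

text \<open>Both numbers are below \<open>2 ^ n\<close>, so their bits from position
  \<open>n\<close> on vanish and the first \<open>n\<close> bits decide. This matches the bitwise
  condition in \<open>on_qubits\<close>.\<close>

lemma eq_power2_iff_bit:
  fixes r :: nat
  assumes "r < 2 ^ n" "i < n"
  shows "r = 2 ^ i \<longleftrightarrow> (\<forall>q<n. bit r q = (q = i))"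
proof
  assume *: "\<forall>q<n. bit r q = (q = i)"
  have "bit r q = bit (2 ^ i :: nat) q" for q
  proof (cases "q < n")
    case True
    with * show ?thesis by (auto simp: bit_exp_iff)
  next
    case False
    from assms(1) have "take_bit n r = r" by (simp add: take_bit_nat_eq_self)
    with False have "\<not> bit r q" by (metis bit_take_bit_iff)
    with False assms(2) show ?thesis by (auto simp: bit_exp_iff)
  qed
  then show "r = 2 ^ i" by (simp add: bit_eq_iff)
qed (auto simp: bit_exp_iff)

lemma unary_ket_eq: "i < n \<Longrightarrow> unary_ket n i = unit_vec (2 ^ n) (2 ^ i)"
proof -
  assume i: "i < n"
  have "horner_sum of_bool 2 (map (\<lambda>q. q = i) [0..<n]) = (2 ^ i :: nat)"
    using i by (intro bit_eqI) (auto simp: bit_horner_sum_bit_iff bit_exp_iff)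
  then show ?thesis by (simp add: unary_ket_def ket_def)
qed

lemma unary_ket_carrier [simp]: "unary_ket n i \<in> carrier_vec (2 ^ n)"
proof -
  have "length (rev (map (\<lambda>q. q = i) [0..<n])) = n" by simp
  then show ?thesis unfolding unary_ket_def ket_def by (metis unit_vec_carrier)
qed

lemma
  shows unary_state_carrier: "unary_state n \<sigma> v \<in> carrier_vec (2 ^ n)"
    and unary_state_index:
      "r < 2 ^ n \<Longrightarrow> unary_state n \<sigma> v $ r = (\<Sum>i<n. v $ i * unary_ket n (\<sigma> i) $ r)"
proof -
  have c: "(\<lambda>i. v $ i \<cdot>\<^sub>v unary_ket n (\<sigma> i)) \<in> {..<n} \<rightarrow> carrier_vec (2 ^ n)"
    by (intro Pi_I) (simp only: smult_carrier_vec unary_ket_carrier)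
  then show "unary_state n \<sigma> v \<in> carrier_vec (2 ^ n)"
    unfolding unary_state_def by (rule finsum_vec_closed)
  show "unary_state n \<sigma> v $ r = (\<Sum>i<n. v $ i * unary_ket n (\<sigma> i) $ r)" if r: "r < 2 ^ n"
    unfolding unary_state_def index_finsum_vec[OF finite_lessThan r c]
    using r by (intro sum.cong) (simp_all add: carrier_vecD[OF unary_ket_carrier])
qed

text \<open>The sum is reindexed along \<open>\<sigma>\<close>. Prescribing \<open>w\<close> at
  \<open>\<sigma> i\<close> avoids the inverse permutation.\<close>

lemma unary_state_eq:
  assumes \<sigma>: "bij_betw \<sigma> {..<n} {..<n}" and w: "\<And>i. i < n \<Longrightarrow> w (\<sigma> i) = v $ i"
  shows "unary_state n \<sigma> v = unary_vec n w"
proof (rule eq_vecI)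
  show "dim_vec (unary_state n \<sigma> v) = dim_vec (unary_vec n w)"
    using carrier_vecD[OF unary_state_carrier] by simp
  fix r assume "r < dim_vec (unary_vec n w)"
  then have r: "r < 2 ^ n" by simp
  have "unary_state n \<sigma> v $ r = (\<Sum>i<n. if r = 2 ^ \<sigma> i then w (\<sigma> i) else 0)"
    unfolding unary_state_index[OF r]
    using r w bij_betwE[OF \<sigma>] by (intro sum.cong) (auto simp: unary_ket_eq)
  also have "\<dots> = (\<Sum>i<n. if r = 2 ^ i then w i else 0)"
    by (rule sum.reindex_bij_betw[OF \<sigma>])
  finally show "unary_state n \<sigma> v $ r = unary_vec n w $ r"
    using r by (simp add: unary_vec_def)
qed

text \<open>Matrices are equal once their columns are, and a column is the image of a unit vector.
  So the action on states already determines the restricted matrix.\<close>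

lemma implementsI:
  assumes M: "M \<in> carrier_mat (2 ^ n) (2 ^ n)" and A: "A \<in> carrier_mat n n"
    and \<sigma>: "bij_betw \<sigma> {..<n} {..<n}" and \<tau>: "bij_betw \<tau> {..<n} {..<n}"
    and eq: "\<And>x. x \<in> carrier_vec n \<Longrightarrow> M *\<^sub>v unary_state n \<sigma> x = unary_state n \<tau> (A *\<^sub>v x)"
  shows "implements M (map (\<lambda>i. unary_ket n (\<sigma> i)) [0..<n]) (map (\<lambda>i. unary_ket n (\<tau> i)) [0..<n]) A"
proof -
  \<comment> \<open>The matrix of kets turns a coefficient vector into a state. It is stated for any
    \<open>\<tau>\<close> because it is used for both the source and the target basis.\<close>
  have cols: "mat_of_cols (2 ^ n) (map (\<lambda>i. unary_ket n (\<tau> i)) [0..<n]) *\<^sub>v x = unary_state n \<tau> x"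
    if x: "x \<in> carrier_vec n" for x \<tau>
  proof (rule eq_vecI)
    show "dim_vec (mat_of_cols (2 ^ n) (map (\<lambda>i. unary_ket n (\<tau> i)) [0..<n]) *\<^sub>v x)
        = dim_vec (unary_state n \<tau> x)"
      using carrier_vecD[OF unary_state_carrier] by simp
    fix r assume "r < dim_vec (unary_state n \<tau> x)"
    then have "r < 2 ^ n" using carrier_vecD[OF unary_state_carrier] by simp
    then show "(mat_of_cols (2 ^ n) (map (\<lambda>i. unary_ket n (\<tau> i)) [0..<n]) *\<^sub>v x) $ r
        = unary_state n \<tau> x $ r"
      using x by (simp add: unary_state_index scalar_prod_def mat_of_cols_def lessThan_atLeast0 mult.commute)
  qed
  have "M * mat_of_cols (2 ^ n) (map (\<lambda>i. unary_ket n (\<sigma> i)) [0..<n])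
      = mat_of_cols (2 ^ n) (map (\<lambda>i. unary_ket n (\<tau> i)) [0..<n]) * A" (is "M * ?S = ?T * A")
  proof (rule mat_col_eqI)
    have ST: "?S \<in> carrier_mat (2 ^ n) n" "?T \<in> carrier_mat (2 ^ n) n"
      by (auto simp: mat_of_cols_def)
    fix j assume "j < dim_col (?T * A)"
    then have j: "j < n" using A by simp
    have e: "col B j = B *\<^sub>v unit_vec n j" if "B \<in> carrier_mat k n" for B :: "complex mat" and k
      using that j by (intro eq_vecI) (auto simp: scalar_prod_right_unit)
    have "col (M * ?S) j = M *\<^sub>v (?S *\<^sub>v unit_vec n j)"
      using e[of "M * ?S" "2 ^ n"] M ST by (simp add: assoc_mult_mat_vec[of _ "2^n" "2^n" _ n])
    also have "\<dots> = ?T *\<^sub>v (A *\<^sub>v unit_vec n j)"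
      using A by (simp add: cols eq)
    also have "\<dots> = col (?T * A) j"
      using e[of "?T * A" "2 ^ n"] A ST by (simp add: assoc_mult_mat_vec[of _ "2^n" n _ n])
    finally show "col (M * ?S) j = col (?T * A) j" .
  qed (use M A in auto)
  then show ?thesis using M A by (auto simp: implements_def)
qed

section \<open>Action of the gates on amplitudes\<close>

fun gate_act :: "gate \<Rightarrow> (nat \<Rightarrow> complex) \<Rightarrow> nat \<Rightarrow> complex" where
  "gate_act (Phase q z) v = v(q := z * v q)"
| "gate_act (RBS p q \<theta>) v =
     v(p := complex_of_real (cos \<theta>) * v p - complex_of_real (sin \<theta>) * v q,
       q := complex_of_real (sin \<theta>) * v p + complex_of_real (cos \<theta>) * v q)"

text \<open>Only columns whose index is a power of 2 meet a nonzero amplitude, so the sum over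
  \<open>2 ^ n\<close> columns collapses to one over \<open>n\<close> qubits.\<close>

lemma on_qubits_mult_unary_vec:
  assumes "r < 2 ^ n"
  shows "(on_qubits n qs M *\<^sub>v unary_vec n v) $ r =
    (\<Sum>i<n. if \<forall>q<n. q \<notin> set qs \<longrightarrow> bit r q = (q = i)
      then M $$ (local_index qs r, local_index qs (2 ^ i)) * v i else 0)"
proof -
  have "(on_qubits n qs M *\<^sub>v unary_vec n v) $ r =
      (\<Sum>c<(2::nat)^n. on_qubits n qs M $$ (r, c) * (\<Sum>i<n. if c = 2 ^ i then v i else 0))"
    using assms by (simp add: on_qubits_def unary_vec_def scalar_prod_def lessThan_atLeast0)
  also have "\<dots> = (\<Sum>c<(2::nat)^n. \<Sum>i<n. if c = 2 ^ i then on_qubits n qs M $$ (r, 2 ^ i) * v i else 0)"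
    by (simp add: sum_distrib_left if_distrib cong: if_cong)
  also have "\<dots> = (\<Sum>i<n. \<Sum>c<(2::nat)^n. if c = 2 ^ i then on_qubits n qs M $$ (r, 2 ^ i) * v i else 0)"
    by (rule sum.swap)
  also have "\<dots> = (\<Sum>i<n. on_qubits n qs M $$ (r, 2 ^ i) * v i)"
    by (intro sum.cong) (auto simp: sum.delta)
  also have "\<dots> = (\<Sum>i<n. if \<forall>q<n. q \<notin> set qs \<longrightarrow> bit r q = (q = i)
      then M $$ (local_index qs r, local_index qs (2 ^ i)) * v i else 0)"
    using assms by (intro sum.cong) (auto simp: on_qubits_def bit_exp_iff)
  finally show ?thesis .
qed

lemma local_index_1: "local_index [q] r = of_bool (bit r q)"
  by (simp add: local_index_def)

lemma local_index_2: "local_index [p, q] r = of_bool (bit r q) + 2 * of_bool (bit r p)"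
  by (simp add: local_index_def)

lemma phase_mat_index:
  "phase_mat z $$ (of_bool a, of_bool b) = (if a = b then if a then z else 1 else 0)"
  by (cases a; cases b) (simp_all add: phase_mat_def mat_of_rows_list_def)

text \<open>Unprimed bits belong to the first qubit, primed ones to the second. The rotation mixes
  only \<open>|01>\<close> and \<open>|10>\<close>, where the two bits differ.\<close>

lemma RBS_mat_index:
  "RBS_mat \<theta> $$ (of_bool a' + 2 * of_bool a, of_bool b' + 2 * of_bool b) =
    (if a = b \<and> a' = b' then if a = a' then 1 else complex_of_real (cos \<theta>)
     else if a \<noteq> a' \<and> b \<noteq> b' then if a' then complex_of_real (sin \<theta>) else - complex_of_real (sin \<theta>) else 0)"
  by (cases a; cases a'; cases b; cases b')
     (simp_all add: RBS_mat_def mat_of_rows_list_def numeral_eq_Suc)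

text \<open>Each gate preserves Hamming weight, so unary states stay unary. For
  \<open>RBS p q\<close> an excitation of \<open>p\<close> is the local state \<open>|10>\<close>
  and one of \<open>q\<close> is \<open>|01>\<close>; any other excitation leaves the pair in
  \<open>|00>\<close>, which is fixed.\<close>

lemma gate_mat_mult_unary_vec:
  assumes "valid_gate n g"
  shows "gate_mat n g *\<^sub>v unary_vec n v = unary_vec n (gate_act g v)"
proof (rule eq_vecI)
  show "dim_vec (gate_mat n g *\<^sub>v unary_vec n v) = dim_vec (unary_vec n (gate_act g v))"
    by (cases g) (auto simp: on_qubits_def)
next
  fix r assume "r < dim_vec (unary_vec n (gate_act g v))"
  then have r: "r < 2 ^ n" by simp
  show "(gate_mat n g *\<^sub>v unary_vec n v) $ r = unary_vec n (gate_act g v) $ r"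
  proof (cases g)
    case (Phase q z)
    with assms have q: "q < n" by simp
    have "(if \<forall>p<n. p \<notin> set [q] \<longrightarrow> bit r p = (p = i)
          then phase_mat z $$ (local_index [q] r, local_index [q] (2 ^ i)) * v i else 0)
        = (if r = 2 ^ i then gate_act g v i else 0)" if i: "i < n" for i
    proof -
      have "r = 2 ^ i \<longleftrightarrow>
          (\<forall>p<n. p \<notin> set [q] \<longrightarrow> bit r p = (p = i)) \<and> bit r q = (q = i)"
        using q unfolding eq_power2_iff_bit[OF r i] by auto
      then show ?thesis
        unfolding Phase local_index_1 phase_mat_index by (auto simp: bit_exp_iff)
    qed
    then have "(gate_mat n g *\<^sub>v unary_vec n v) $ r = (\<Sum>i<n. if r = 2 ^ i then gate_act g v i else 0)"
      unfolding Phase gate_mat.simps on_qubits_mult_unary_vec[OF r] by (intro sum.cong) auto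
    then show ?thesis using r by (simp add: unary_vec_def)
  next
    case (RBS p q \<theta>)
    with assms have pq: "p < n" "q < n" "p \<noteq> q" by auto
    define c s :: complex where "c = complex_of_real (cos \<theta>)" and "s = complex_of_real (sin \<theta>)"
    define others where "others i \<longleftrightarrow> (\<forall>k<n. k \<notin> set [p, q] \<longrightarrow> bit r k = (k = i))" for i
    have iff: "r = 2 ^ i \<longleftrightarrow> others i \<and> bit r p = (p = i) \<and> bit r q = (q = i)" if "i < n" for i
      using pq unfolding eq_power2_iff_bit[OF r that] others_def by auto
    \<comment> \<open>Both sides say that \<open>r\<close> has no set bit off \<open>p\<close> and
      \<open>q\<close>.\<close>
    have pq_others: "others p \<longleftrightarrow> others q" by (auto simp: others_def)
    \<comment> \<open>Contributions sorted by source: the columns of \<open>p\<close> and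
      \<open>q\<close> each feed the two rows \<open>2 ^ p\<close> and \<open>2 ^ q\<close>, every
      other column feeds only its own row.\<close>
    have "(if others i
          then RBS_mat \<theta> $$ (local_index [p, q] r, local_index [p, q] (2 ^ i)) * v i else 0)
        = (if i = p then if r = 2 ^ p then c * v p else if r = 2 ^ q then s * v p else 0 else 0)
        + (if i = q then if r = 2 ^ p then - s * v q else if r = 2 ^ q then c * v q else 0 else 0)
        + (if i \<noteq> p \<and> i \<noteq> q \<and> r = 2 ^ i then v i else 0)" (is "_ = ?a i + ?b i + ?c i") if i: "i < n" for i
      unfolding iff[OF i] iff[OF pq(1)] iff[OF pq(2)] local_index_2 RBS_mat_index
      using pq(3) pq_others
      by (auto simp: bit_exp_iff c_def s_def)
    then have "(gate_mat n g *\<^sub>v unary_vec n v) $ r = (\<Sum>i<n. ?a i + ?b i + ?c i)"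
      using r unfolding RBS gate_mat.simps on_qubits_mult_unary_vec[OF r] others_def[symmetric]
      by (intro sum.cong) auto
    also have "\<dots> = (\<Sum>i<n. if r = 2 ^ i then gate_act g v i else 0)"
    proof -
      \<comment> \<open>The contributions of \<open>p\<close> and \<open>q\<close> are regrouped
        from source column to target row, the form in which \<open>gate_act\<close> gives
        them.\<close>
      have "(\<Sum>i<n. ?a i + ?b i) = (\<Sum>i<n. ?a i) + (\<Sum>i<n. ?b i)" by (rule sum.distrib)
      also have "\<dots> = (if r = 2 ^ p then c * v p - s * v q else if r = 2 ^ q then s * v p + c * v q else 0)"
        using pq by (auto simp: sum.delta)
      also have "\<dots> = (\<Sum>i<n. if i = p then if r = 2 ^ p then c * v p - s * v q else 0 else 0)
          + (\<Sum>i<n. if i = q then if r = 2 ^ q then s * v p + c * v q else 0 else 0)"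
        (is "_ = sum ?d _ + sum ?e _")
        using pq by (auto simp: sum.delta)
      finally have "(\<Sum>i<n. ?a i + ?b i + ?c i) = (\<Sum>i<n. ?d i + ?e i + ?c i)"
        by (simp only: sum.distrib)
      also have "\<dots> = (\<Sum>i<n. if r = 2 ^ i then gate_act g v i else 0)"
        using pq(3) by (intro sum.cong) (auto simp: RBS c_def s_def)
      finally show ?thesis .
    qed
    finally show ?thesis using r by (simp add: unary_vec_def)
  qed
qed

section \<open>Butterfly diagrams\<close>

text \<open>
  Both the amplitudes and the schedules of the two kinds of operations evolve under the diagram in
  this way, for different functions \<open>f\<close> and \<open>g\<close>.
\<close>

fun butterfly_map :: "(nat \<Rightarrow> 'a \<Rightarrow> 'a \<Rightarrow> 'a) \<Rightarrow> (nat \<Rightarrow> 'a \<Rightarrow> 'a \<Rightarrow> 'a) \<Rightarrow>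
    butterfly \<Rightarrow> (nat \<Rightarrow> 'a) \<Rightarrow> nat \<Rightarrow> 'a" where
  "butterfly_map f g (i, j, k) v = v(i := f k (v i) (v j), j := g k (v i) (v j))"

text \<open>As \<open>J \<le> N\<close>, the wire pairs of a column are disjoint, so every operation
  still reads the original values of \<open>v\<close>. Bounding the column by \<open>J\<close>
  separately from the offset \<open>N\<close> permits induction.\<close>

lemma fold_butterfly_column:
  assumes "J \<le> N"
  shows "fold (butterfly_map f g) (map (\<lambda>j. (l + j, l + N + j, j * s)) [0..<J]) v w =
    (if l \<le> w \<and> w < l + J then f ((w - l) * s) (v w) (v (w + N))
     else if l + N \<le> w \<and> w < l + N + J then g ((w - (l + N)) * s) (v (w - N)) (v w)
     else v w)"
  using assms
proof (induction J arbitrary: w)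
  case (Suc J)
  then have IH: "fold (butterfly_map f g) (map (\<lambda>j. (l + j, l + N + j, j * s)) [0..<J]) v w =
    (if l \<le> w \<and> w < l + J then f ((w - l) * s) (v w) (v (w + N))
     else if l + N \<le> w \<and> w < l + N + J then g ((w - (l + N)) * s) (v (w - N)) (v w)
     else v w)" for w by simp
  have J: "J < N" using Suc.prems by simp
  consider "w = l + J" | "w = l + N + J" | "w \<noteq> l + J" "w \<noteq> l + N + J" by blast
  then show ?case
  proof cases
    case 1
    then show ?thesis using J by (simp add: IH) (simp add: add.commute add.left_commute)
  next
    case 2
    then show ?thesis using J by (simp add: IH)
  next
    case 3
    then have "w < l + Suc J \<longleftrightarrow> w < l + J" "w < l + N + Suc J \<longleftrightarrow> w < l + N + J" by auto
    with 3 show ?thesis by (simp add: IH)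
  qed
qed auto

lemma fold_fft_diagram_Suc:
  "fold (butterfly_map f g) (fft_diagram (Suc m) l s) v =
    fold (butterfly_map f g) (map (\<lambda>j. (l + j, l + 2 ^ m + j, j * s)) [0..<2 ^ m])
      (fold (butterfly_map f g) (fft_diagram m (l + 2 ^ m) (2 * s))
        (fold (butterfly_map f g) (fft_diagram m l (2 * s)) v))"
  by simp

text \<open>The strict inequality supplies the distinct qubits that a valid \<open>RBS\<close> gate
  requires.\<close>

lemma fft_diagram_wires:
  "(i, j, k) \<in> set (fft_diagram m l s) \<Longrightarrow> l \<le> i \<and> i < j \<and> j < l + 2 ^ m"
  by (induction m arbitrary: l s) fastforce+

text \<open>The last column alone meets every wire of the block; the diagram of size 1 is empty,
  hence \<open>Suc m\<close>.\<close>

lemma Union_butterfly_wires: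
  "(\<Union>b\<in>set (fft_diagram (Suc m) l s). butterfly_wires b) = {l..<l + 2 ^ Suc m}"
proof
  show "(\<Union>b\<in>set (fft_diagram (Suc m) l s). butterfly_wires b) \<subseteq> {l..<l + 2 ^ Suc m}"
    using fft_diagram_wires[of _ _ _ "Suc m" l s] by (fastforce simp del: fft_diagram.simps)
  show "{l..<l + 2 ^ Suc m} \<subseteq> (\<Union>b\<in>set (fft_diagram (Suc m) l s). butterfly_wires b)"
  proof
    fix w assume w: "w \<in> {l..<l + 2 ^ Suc m}"
    \<comment> \<open>The position of \<open>w\<close> within its half of the block.\<close>
    define j where "j = (if w < l + 2 ^ m then w - l else w - (l + 2 ^ m))"
    have "j < 2 ^ m" and "w \<in> butterfly_wires (l + j, l + 2 ^ m + j, j * s)"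
      using w by (auto simp: j_def)
    then show "w \<in> (\<Union>b\<in>set (fft_diagram (Suc m) l s). butterfly_wires b)"
      by (auto simp del: butterfly_wires.simps)
  qed
qed

text \<open>The count satisfies \<open>L (Suc m) = 2 * L m + 2 ^ m\<close>; doubling it avoids a
  division.\<close>

lemma length_fft_diagram: "2 * length (fft_diagram m l s) = m * 2 ^ m"
proof (induction m arbitrary: l s)
  case (Suc m)
  from Suc[of l "2 * s"] Suc[of "l + 2 ^ m" "2 * s"] show ?case
    by (simp add: algebra_simps)
qed simp

lemma fold_fft_diagram_outside:
  "w \<notin> {l..<l + 2 ^ m} \<Longrightarrow> fold (butterfly_map f g) (fft_diagram m l s) v w = v w"
proof (induction m arbitrary: l s v)
  case (Suc m)
  then show ?case
    unfolding fold_fft_diagram_Suc by (subst fold_butterfly_column) (auto simp: Suc.IH)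
qed simp

text \<open>Meant for schedules: if all wires of a block are free at the same time \<open>c\<close>,
  each of the \<open>m\<close> columns delays all of them equally, by \<open>d\<close>.\<close>

lemma fold_fft_diagram_const:
  assumes step: "\<And>k c. f k c c = c + d" "\<And>k c. g k c c = c + (d :: nat)"
    and v: "\<And>w. w \<in> {l..<l + 2 ^ m} \<Longrightarrow> v w = c"
  shows "w \<in> {l..<l + 2 ^ m} \<Longrightarrow>
    fold (butterfly_map f g) (fft_diagram m l s) v w = c + m * d"
  using v
proof (induction m arbitrary: l s v w)
  case (Suc m)
  define u where "u = fold (butterfly_map f g) (fft_diagram m (l + 2 ^ m) (2 * s))
        (fold (butterfly_map f g) (fft_diagram m l (2 * s)) v)"
  have "u x = c + m * d" if x: "x \<in> {l..<l + 2 ^ Suc m}" for x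
  \<comment> \<open>The two half-size diagrams act on disjoint wires: the second leaves the lower
    half alone, the first the upper half.\<close>
  proof (cases "x < l + 2 ^ m")
    case True
    then have "u x = fold (butterfly_map f g) (fft_diagram m l (2 * s)) v x"
      unfolding u_def by (intro fold_fft_diagram_outside) auto
    also have "\<dots> = c + m * d" using True x Suc.prems by (intro Suc.IH) auto
    finally show ?thesis .
  next
    case False
    then show ?thesis unfolding u_def using x Suc.prems
      by (intro Suc.IH) (auto simp: fold_fft_diagram_outside)
  qed
  \<comment> \<open>The partner of an upper wire lies in the block too and so carries the same
    value.\<close>
  moreover have "w - 2 ^ m \<in> {l..<l + 2 ^ Suc m}" if "l + 2 ^ m \<le> w"
    using that Suc.prems(1) by auto
  ultimately show ?case using Suc.prems(1)
    unfolding fold_fft_diagram_Suc u_def[symmetric]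
    by (subst fold_butterfly_column) (auto simp: step)
qed simp

section \<open>Depth and gate count\<close>

lemma depth_const:
  assumes "\<Union> (set Qs) = {..<n}" "0 < n" "\<And>q. q < n \<Longrightarrow> fold schedule Qs (\<lambda>_. 0) q = c"
  shows "depth Qs = c"
proof -
  have "fold schedule Qs (\<lambda>_. 0) ` {..<n} = {c}" using assms by force
  then show ?thesis using assms by (simp add: depth_def)
qed

lemma fold_concat_map: "fold h (concat (map f xs)) = fold (\<lambda>x. fold h (f x)) xs"
  by (induction xs) auto

text \<open>A radix-2 operation frees both its wires at \<open>Suc (max a b)\<close>, one step later
  when \<open>a = b\<close>.\<close>

lemma depth_fft_diagram: "depth (map butterfly_wires (fft_diagram m 0 s)) = m"
proof (cases m)
  case (Suc m')
  have "fold schedule (map butterfly_wires (fft_diagram m 0 s)) (\<lambda>_. 0) =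
      fold (butterfly_map (\<lambda>_ a b. Suc (max a b)) (\<lambda>_ a b. Suc (max a b))) (fft_diagram m 0 s) (\<lambda>_. 0)"
    unfolding fold_map by (rule List.fold_cong) (auto simp: schedule_def fun_eq_iff)
  then have "fold schedule (map butterfly_wires (fft_diagram m 0 s)) (\<lambda>_. 0) q = m"
    if "q < 2 ^ m" for q
    using that fold_fft_diagram_const[where d = 1 and l = 0 and c = 0] by simp
  then show ?thesis
    using Union_butterfly_wires[of m' 0 s] unfolding Suc
    by (intro depth_const[of _ "2 ^ Suc m'"]) (auto simp: lessThan_atLeast0 simp del: fft_diagram.simps)
qed (simp add: depth_def)

lemma gate_qubits_butterfly_gates:
  "\<Union> (gate_qubits ` set (butterfly_gates z b)) = butterfly_wires b"
  by (cases b) auto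

lemma Union_gate_qubits_unary_qft:
  "0 < m \<Longrightarrow> (\<Union>g\<in>set (unary_qft m). gate_qubits g) = {..<2 ^ m}"
  using Union_butterfly_wires[of "m - 1" 0 1]
  by (simp add: unary_qft_def gate_qubits_butterfly_gates lessThan_atLeast0 UN_UN_flatten
       del: fft_diagram.simps)

text \<open>The phase gate delays wire \<open>j\<close> to \<open>Suc b\<close> and the
  \<open>RBS\<close> gate then waits for both wires, giving \<open>Suc (max a (Suc b))\<close>.
  Starting from equal times, a column costs 2 steps.\<close>

lemma depth_unary_qft: "depth (map gate_qubits (unary_qft m)) = 2 * m"
proof (cases m)
  case (Suc m')
  have "fold schedule (map gate_qubits (unary_qft m)) (\<lambda>_. 0) =
      fold (butterfly_map (\<lambda>_ a b. Suc (max a (Suc b))) (\<lambda>_ a b. Suc (max a (Suc b))))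
        (fft_diagram m 0 1) (\<lambda>_. 0)"
    unfolding fold_map unary_qft_def fold_concat_map
  proof (rule List.fold_cong[OF refl refl])
    fix b assume "b \<in> set (fft_diagram m 0 1)"
    with fft_diagram_wires show "fold (schedule \<circ> gate_qubits) (butterfly_gates (omega (2 ^ m)) b) =
        butterfly_map (\<lambda>_ a b. Suc (max a (Suc b))) (\<lambda>_ a b. Suc (max a (Suc b))) b"
      by (cases b) (force simp: schedule_def max.commute)
  qed
  then have "fold schedule (map gate_qubits (unary_qft m)) (\<lambda>_. 0) q = 2 * m"
    if "q < 2 ^ m" for q
    using that fold_fft_diagram_const[where d = 2 and l = 0 and c = 0] by simp
  then show ?thesis
    using Union_gate_qubits_unary_qft[of m] Suc
    by (intro depth_const[of _ "2 ^ m"]) auto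
qed (simp add: depth_def unary_qft_def)

lemma length_unary_qft: "length (unary_qft m) = m * 2 ^ m"
proof -
  have "length \<circ> butterfly_gates z = (\<lambda>_. 2)" for z by auto
  then show ?thesis
    by (simp add: unary_qft_def length_concat comp_def sum_list_triv length_fft_diagram[symmetric, of m 0 1])
qed

lemma valid_gate_unary_qft:
  assumes "g \<in> set (unary_qft m)"
  shows "valid_gate (2 ^ m) g"
proof -
  from assms obtain i j k where b: "(i, j, k) \<in> set (fft_diagram m 0 1)"
    and g: "g \<in> set (butterfly_gates (omega (2 ^ m)) (i, j, k))"
    by (auto simp: unary_qft_def simp del: butterfly_gates.simps)
  from fft_diagram_wires[OF b] g show ?thesis by auto
qed

section \<open>The discrete Fourier transform\<close>

lemma omega_eq_cis: "omega n = cis (2 * pi / n)"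
  by (simp add: omega_def cis_conv_exp algebra_simps)

lemma omega_power_eq_cis: "omega n ^ k = cis (2 * pi * real k / real n)"
  by (simp add: omega_eq_cis DeMoivre algebra_simps)

lemma omega_power_self: "0 < n \<Longrightarrow> omega n ^ n = 1"
  by (simp add: omega_power_eq_cis)

lemma omega_nonzero: "omega n \<noteq> 0"
  by (simp add: omega_eq_cis)

lemma omega_double_power2: "omega (2 * n) ^ 2 = omega n"
  by (simp add: omega_eq_cis DeMoivre)

lemma omega_double_power: "0 < n \<Longrightarrow> omega (2 * n) ^ n = -1"
  by (simp add: omega_power_eq_cis)

section \<open>Bit reversal\<close>

lemma bit_bit_reversal: "bit (bit_reversal m i) q \<longleftrightarrow> q < m \<and> bit i (m - Suc q)"
  by (auto simp: bit_reversal_def bit_horner_sum_bit_iff rev_nth)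

lemma bit_reversal_less: "bit_reversal m i < 2 ^ m"
proof -
  have "take_bit m (bit_reversal m i) = bit_reversal m i"
    by (auto simp: bit_eq_iff bit_take_bit_iff bit_bit_reversal)
  then show ?thesis by (simp only: take_bit_nat_eq_self_iff)
qed

lemma bit_reversal_bit_reversal: "bit_reversal m (bit_reversal m i) = take_bit m i"
  by (auto simp: bit_eq_iff bit_take_bit_iff bit_bit_reversal)

lemma bit_reversal_involution: "i < 2 ^ m \<Longrightarrow> bit_reversal m (bit_reversal m i) = i"
  by (simp add: bit_reversal_bit_reversal take_bit_nat_eq_self)

lemma bij_betw_bit_reversal: "bij_betw (bit_reversal m) {..<2 ^ m} {..<2 ^ m}"
  by (rule bij_betwI[where g = "bit_reversal m"])
     (auto simp: bit_reversal_less bit_reversal_involution)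

text \<open>The lowest bit 0 of an even index becomes the top bit of the reversal, so even-indexed
  inputs enter on the lower half of the wires.\<close>

lemma bit_reversal_double: "bit_reversal (Suc m) (2 * i) = bit_reversal m i"
proof (rule bit_eqI)
  fix q show "bit (bit_reversal (Suc m) (2 * i)) q = bit (bit_reversal m i) q"
  proof (cases "q < m")
    case True
    then have "m - q = Suc (m - Suc q)" by simp
    with True show ?thesis by (simp add: bit_bit_reversal bit_Suc)
  qed (auto simp: bit_bit_reversal bit_0 less_Suc_eq)
qed

text \<open>Here the lowest bit 1 becomes the top bit \<open>2 ^ m\<close>: odd-indexed inputs enter
  on the upper half.\<close>

lemma bit_reversal_Suc_double: "bit_reversal (Suc m) (Suc (2 * i)) = 2 ^ m + bit_reversal m i"
proof -
  \<comment> \<open>The summands share no set bit, so addition is bitwise disjunction.\<close>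
  have "2 ^ m + bit_reversal m i = or (2 ^ m) (bit_reversal m i)"
    by (intro disjunctive_add_eq_or bit_eqI) (auto simp: bit_and_iff bit_exp_iff bit_bit_reversal)
  also have "\<dots> = bit_reversal (Suc m) (Suc (2 * i))"
  proof (rule bit_eqI)
    fix q show "bit (or (2 ^ m) (bit_reversal m i)) q = bit (bit_reversal (Suc m) (Suc (2 * i))) q"
    proof (cases "q < m")
      case True
      then have "m - q = Suc (m - Suc q)" by simp
      with True show ?thesis by (simp add: bit_bit_reversal bit_Suc bit_or_iff bit_exp_iff)
    qed (auto simp: bit_bit_reversal bit_0 less_Suc_eq bit_or_iff bit_exp_iff)
  qed
  finally show ?thesis ..
qed

section \<open>Splitting the Fourier sum by parity\<close>

lemma sum_even_odd:
  fixes f :: "nat \<Rightarrow> 'a :: comm_monoid_add"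
  shows "(\<Sum>i<2 * n. f i) = (\<Sum>i<n. f (2 * i)) + (\<Sum>i<n. f (Suc (2 * i)))"
  by (induction n) (simp_all add: ac_simps)

text \<open>The factor \<open>1 / sqrt 2\<close> is the one contributed by \<open>RBS\<close> at
  angle \<open>- pi / 4\<close>.\<close>

definition radix2_sum :: "complex \<Rightarrow> nat \<Rightarrow> complex \<Rightarrow> complex \<Rightarrow> complex" where
  "radix2_sum \<omega> k a b = (a + \<omega> ^ k * b) / sqrt 2"

definition radix2_diff :: "complex \<Rightarrow> nat \<Rightarrow> complex \<Rightarrow> complex \<Rightarrow> complex" where
  "radix2_diff \<omega> k a b = (a - \<omega> ^ k * b) / sqrt 2"

text \<open>Decimation in time. The root \<open>\<omega>\<close> stays that of the whole diagram
  while subdiagrams use its power \<open>\<omega> ^ s\<close>, so \<open>s\<close> and the offset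
  \<open>l\<close> are generalised in the induction.\<close>

lemma fold_fft_diagram_eq_dft:
  assumes "\<omega> ^ s = omega (2 ^ m)" and "j < 2 ^ m"
  shows "fold (butterfly_map (radix2_sum \<omega>) (radix2_diff \<omega>)) (fft_diagram m l s) v (l + j) =
    (\<Sum>i<2 ^ m. omega (2 ^ m) ^ (j * i) * v (l + bit_reversal m i)) / complex_of_real (sqrt 2) ^ m"
  using assms
proof (induction m arbitrary: l s v j)
  case 0
  then show ?case by (simp add: bit_reversal_def)
next
  case (Suc m)
  let ?F = "\<lambda>l. fold (butterfly_map (radix2_sum \<omega>) (radix2_diff \<omega>)) (fft_diagram m l (2 * s))"
  let ?W = "omega (2 ^ Suc m)"
  define r where "r = complex_of_real (sqrt 2)"
  define u where "u = ?F (l + 2 ^ m) (?F l v)"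
  \<comment> \<open>Unnormalised half-size transforms of the even- and odd-indexed inputs, defined
    for every \<open>j\<close> so that their periodicity can be used beyond
    \<open>2 ^ m\<close>.\<close>
  define Ev Od where "Ev j = (\<Sum>i<2 ^ m. omega (2 ^ m) ^ (j * i) * v (l + bit_reversal m i))"
    and "Od j = (\<Sum>i<2 ^ m. omega (2 ^ m) ^ (j * i) * v (l + 2 ^ m + bit_reversal m i))" for j
  have W2: "?W ^ 2 = omega (2 ^ m)" using omega_double_power2[of "2 ^ m"] by simp
  have Wm: "?W ^ (2 ^ m) = -1" using omega_double_power[of "2 ^ m"] by simp
  have \<omega>2: "\<omega> ^ (2 * s) = omega (2 ^ m)"
    using Suc.prems(1) W2 by (simp add: power_mult mult.commute)
  have even: "u (l + j) = Ev j / r ^ m" if "j < 2 ^ m" for j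
  proof -
    have "u (l + j) = ?F l v (l + j)"
      unfolding u_def using that by (intro fold_fft_diagram_outside) auto
    then show ?thesis using Suc.IH[OF \<omega>2 that] by (simp add: Ev_def r_def)
  qed
  have odd: "u (l + 2 ^ m + j) = Od j / r ^ m" if "j < 2 ^ m" for j
    unfolding u_def Suc.IH[OF \<omega>2 that] Od_def r_def using bit_reversal_less
    by (subst fold_fft_diagram_outside) auto
  have WE: "?W ^ (j * (2 * i)) = omega (2 ^ m) ^ (j * i)" for i j
    using W2 by (metis mult.left_commute power_mult)
  have WO: "?W ^ (j * Suc (2 * i)) = ?W ^ j * omega (2 ^ m) ^ (j * i)" for i j
    using WE[of j i] by (simp add: power_add)
  \<comment> \<open>The Cooley-Tukey identity, with twiddle factor \<open>?W ^ j\<close>.\<close>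
  have split: "(\<Sum>i<2 ^ Suc m. ?W ^ (j * i) * v (l + bit_reversal (Suc m) i)) = Ev j + ?W ^ j * Od j" for j
    unfolding power_Suc[of 2 m] sum_even_odd bit_reversal_double bit_reversal_Suc_double Ev_def Od_def
    unfolding power_Suc[of 2 m, symmetric] WE WO
    by (simp add: sum_distrib_left mult.assoc add.assoc)
  have \<omega>s: "\<omega> ^ (j * s) = ?W ^ j" for j
    using Suc.prems(1) by (metis mult.commute power_mult)
  show ?case
  proof (cases "j < 2 ^ m")
    case True
    then show ?thesis
      unfolding split fold_fft_diagram_Suc u_def[symmetric]
      using even[OF True] odd[OF True]
      by (subst fold_butterfly_column)
         (simp_all add: radix2_sum_def \<omega>s r_def[symmetric] ac_simps add_divide_distrib)
  next
    case False
    define k where "k = j - 2 ^ m"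
    with False Suc.prems(2) have k: "k < 2 ^ m" and j: "j = 2 ^ m + k" by auto
    \<comment> \<open>On the upper half \<open>Ev\<close> and \<open>Od\<close> repeat with period
      \<open>2 ^ m\<close> while the twiddle factor changes sign, which turns the sum into the
      difference.\<close>
    have period: "omega (2 ^ m) ^ (j * i) = omega (2 ^ m) ^ (k * i)" for i
      unfolding j by (simp add: add_mult_distrib power_add power_mult omega_power_self)
    have "Ev j = Ev k" "Od j = Od k" by (simp_all add: Ev_def Od_def period)
    moreover have "?W ^ j = - (?W ^ k)" unfolding j power_add Wm by simp
    ultimately show ?thesis
      unfolding split fold_fft_diagram_Suc u_def[symmetric]
      using even[OF k] odd[OF k] k
      by (subst fold_butterfly_column)
         (simp_all add: radix2_diff_def \<omega>s r_def[symmetric] ac_simps diff_divide_distrib j)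
  qed
qed

section \<open>Unitarity of the Fourier matrix\<close>

lemma scaled_fourier_mat_carrier: "scaled_fourier_mat n \<in> carrier_mat n n"
  by (simp add: fourier_mat_def)

lemma scaled_fourier_mat_mult_index:
  assumes "x \<in> carrier_vec n" "j < n"
  shows "(scaled_fourier_mat n *\<^sub>v x) $ j = (\<Sum>i<n. omega n ^ (j * i) * x $ i) / complex_of_real (sqrt n)"
  using assms
  by (simp add: fourier_mat_def scalar_prod_def lessThan_atLeast0 sum_divide_distrib)

text \<open>Orthogonality of characters: the summands are powers of an \<open>n\<close>-th root of
  unity \<open>z\<close>, which differs from 1 when \<open>j \<noteq> l\<close>, so the geometric
  sum vanishes.\<close>

lemma sum_omega_powers:
  assumes "0 < n" "j < n" "l < n"
  shows "(\<Sum>k<n. omega n ^ (j * k) * cnj (omega n ^ (l * k))) = (if j = l then of_nat n else 0)"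
proof -
  define z where "z = omega n ^ j * cnj (omega n ^ l)"
  have unit: "omega n ^ k * cnj (omega n ^ k) = 1" for k
    by (simp add: omega_power_eq_cis cis_cnj cis_mult del: complex_cnj_power)
  have z: "omega n ^ (j * k) * cnj (omega n ^ (l * k)) = z ^ k" for k
    by (simp add: z_def power_mult power_mult_distrib)
  show ?thesis
  proof (cases "j = l")
    case True
    then show ?thesis by (simp add: unit del: complex_cnj_power)
  next
    case False
    have "z \<noteq> 1"
    proof
      assume "z = 1"
      \<comment> \<open>Multiplying \<open>z = 1\<close> by \<open>omega n ^ l\<close> cancels the
        conjugate, contradicting that the \<open>n\<close> roots of unity are distinct.\<close>
      then have "omega n ^ j = omega n ^ l"
        using unit[of l] unfolding z_def by (metis mult.assoc mult.commute mult_1_left)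
      moreover have "inj_on (\<lambda>k. cis (2 * pi * real k / real n)) {..<n}"
        using bij_betw_roots_unity[OF assms(1)] by (rule bij_betw_imp_inj_on)
      ultimately show False
        using False assms unfolding omega_power_eq_cis by (auto dest: inj_onD)
    qed
    moreover have "z ^ n = 1"
    proof -
      have "z ^ n = (omega n ^ n) ^ j * cnj ((omega n ^ n) ^ l)"
        by (simp add: z_def power_mult_distrib power_mult[symmetric] mult.commute)
      then show ?thesis by (simp add: omega_power_self[OF assms(1)])
    qed
    ultimately show ?thesis
      using False unfolding z by (simp add: geometric_sum)
  qed
qed

lemma mat_adjoint_carrier: "A \<in> carrier_mat n k \<Longrightarrow> mat_adjoint A \<in> carrier_mat k n"
  by (auto simp: mat_adjoint_def)

lemma mat_adjoint_index:
  "A \<in> carrier_mat n k \<Longrightarrow> i < k \<Longrightarrow> j < n \<Longrightarrow> mat_adjoint A $$ (i, j) = conjugate (A $$ (j, i))"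
  by (auto simp: mat_adjoint_def mat_of_rows_index)

text \<open>The rows are orthonormal, which gives a right inverse; for square matrices it is also a
  left inverse.\<close>

lemma unitary_scaled_fourier_mat:
  assumes "0 < n"
  shows "unitary_mat (scaled_fourier_mat n)"
proof -
  define F where "F = scaled_fourier_mat n"
  have F: "F \<in> carrier_mat n n" unfolding F_def by (rule scaled_fourier_mat_carrier)
  note F' = mat_adjoint_carrier[OF F]
  define c where "c = complex_of_real (1 / sqrt n)"
  have cc: "c * cnj c * of_nat n = 1"
    using assms by (simp add: c_def complex_eq_iff)
  have F_index: "F $$ (i, j) = c * omega n ^ (i * j)" if "i < n" "j < n" for i j
    using that by (simp add: F_def fourier_mat_def c_def)
  have inv: "F * mat_adjoint F = 1\<^sub>m n"
  proof (rule eq_matI)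
    fix j l assume "j < dim_row (1\<^sub>m n :: complex mat)" "l < dim_col (1\<^sub>m n :: complex mat)"
    then have jl: "j < n" "l < n" by auto
    have "(F * mat_adjoint F) $$ (j, l) = (\<Sum>k<n. F $$ (j, k) * mat_adjoint F $$ (k, l))"
      using F F' jl by (simp add: scalar_prod_def lessThan_atLeast0)
    also have "\<dots> = (\<Sum>k<n. c * omega n ^ (j * k) * cnj (c * omega n ^ (l * k)))"
      using jl by (intro sum.cong refl) (simp add: mat_adjoint_index[OF F] F_index)
    also have "\<dots> = c * cnj c * (\<Sum>k<n. omega n ^ (j * k) * cnj (omega n ^ (l * k)))"
      by (simp add: sum_distrib_left ac_simps)
    also have "\<dots> = (if j = l then 1 else 0)"
      unfolding sum_omega_powers[OF assms jl] using cc by simp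
    finally show "(F * mat_adjoint F) $$ (j, l) = 1\<^sub>m n $$ (j, l)" using jl by simp
  qed (use F F' in auto)
  moreover have "mat_adjoint F * F = 1\<^sub>m n"
    by (rule mat_mult_left_right_inverse[OF F F' inv])
  ultimately show ?thesis
    using F F' unfolding F_def[symmetric]
    by (simp add: unitary_mat_def inverts_mat_def square_mat.simps)
qed

section \<open>The unary QFT circuit\<close>

lemma gate_mat_carrier: "gate_mat n g \<in> carrier_mat (2 ^ n) (2 ^ n)"
  by (cases g) (auto simp: on_qubits_def)

lemma circuit_mat_snoc: "circuit_mat n (C @ [g]) = gate_mat n g * circuit_mat n C"
  by (simp add: circuit_mat_def)

lemma circuit_mat_carrier: "circuit_mat n C \<in> carrier_mat (2 ^ n) (2 ^ n)"
proof (induction C rule: rev_induct)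
  case Nil
  show ?case by (simp add: circuit_mat_def)
next
  case (snoc g C)
  then show ?case unfolding circuit_mat_snoc by (rule mult_carrier_mat[OF gate_mat_carrier])
qed

lemma circuit_mat_mult_unary_vec:
  assumes "\<forall>g\<in>set C. valid_gate n g"
  shows "circuit_mat n C *\<^sub>v unary_vec n v = unary_vec n (fold gate_act C v)"
  using assms
proof (induction C rule: rev_induct)
  case Nil
  show ?case by (simp add: circuit_mat_def)
next
  case (snoc g C)
  have "circuit_mat n (C @ [g]) *\<^sub>v unary_vec n v
      = gate_mat n g *\<^sub>v (circuit_mat n C *\<^sub>v unary_vec n v)"
    unfolding circuit_mat_snoc
    by (rule assoc_mult_mat_vec[OF gate_mat_carrier circuit_mat_carrier unary_vec_carrier])
  with snoc show ?case by (simp add: gate_mat_mult_unary_vec)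
qed

text \<open>Gates are undone from the last to the first. A zero phase is excluded because it erases
  an amplitude; for \<open>RBS\<close> the claim is \<open>cos^2 + sin^2 = 1\<close>.\<close>

lemma fold_gate_act_inverse_circuit:
  assumes "\<forall>g\<in>set C. valid_gate n g" "\<forall>q. Phase q 0 \<notin> set C"
  shows "fold gate_act (inverse_circuit C) (fold gate_act C v) = v"
  using assms
proof (induction C arbitrary: v)
  case (Cons g C)
  have "gate_act (inverse_gate g) (gate_act g v) = v"
  proof (cases g)
    case (Phase q z)
    with Cons.prems have "z \<noteq> 0" by auto
    with Phase show ?thesis by (auto simp: fun_eq_iff)
  next
    case (RBS p q \<theta>)
    define c s where "c = complex_of_real (cos \<theta>)" and "s = complex_of_real (sin \<theta>)"
    have "c * c + s * s = complex_of_real ((cos \<theta>)\<^sup>2 + (sin \<theta>)\<^sup>2)"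
      by (simp only: c_def s_def of_real_add of_real_power power2_eq_square of_real_mult)
    then have cs: "c * c + s * s = 1" by simp
    have "c * (c * x - s * y) + s * (s * x + c * y) = (c * c + s * s) * x"
      "c * (s * x + c * y) - s * (c * x - s * y) = (c * c + s * s) * y" for x y
      by (simp_all only: algebra_simps)
    note inv = this[unfolded cs mult_1]
    with RBS Cons.prems show ?thesis by (simp add: fun_eq_iff c_def[symmetric] s_def[symmetric] inv)
  qed
  moreover have "fold gate_act (inverse_circuit C) (fold gate_act C u) = u" for u
    using Cons by simp
  ultimately show ?case by (simp add: inverse_circuit_def)
qed (simp add: inverse_circuit_def)

lemma valid_gate_inverse_circuit:
  assumes "\<forall>g\<in>set C. valid_gate n g" "g \<in> set (inverse_circuit C)"
  shows "valid_gate n g"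
proof -
  from assms(2) obtain h where "h \<in> set C" "g = inverse_gate h"
    by (auto simp: inverse_circuit_def)
  with assms(1) show ?thesis by (cases h) auto
qed

lemma valid_gate_relabel_gate:
  assumes "inj_on \<sigma> {..<n}" "\<sigma> ` {..<n} \<subseteq> {..<n}" "valid_gate n g"
  shows "valid_gate n (relabel_gate \<sigma> g)"
  using assms by (cases g) (auto simp: inj_on_def image_subset_iff)

text \<open>Injectivity of \<open>\<sigma>\<close> keeps distinct qubits distinct, so both circuits
  update corresponding amplitudes in the same way.\<close>

lemma fold_gate_act_relabel:
  assumes "inj_on \<sigma> {..<n}" "\<forall>g\<in>set C. valid_gate n g" "\<And>i. i < n \<Longrightarrow> w (\<sigma> i) = v i" "i < n"
  shows "fold gate_act (map (relabel_gate \<sigma>) C) w (\<sigma> i) = fold gate_act C v i"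
  using assms(2-4)
proof (induction C arbitrary: v w i)
  case (Cons g C)
  have eq: "\<sigma> i = \<sigma> j \<longleftrightarrow> i = j" if "i < n" "j < n" for i j
    using assms(1) that by (auto simp: inj_on_def)
  have "gate_act (relabel_gate \<sigma> g) w (\<sigma> j) = gate_act g v j" if "j < n" for j
    using Cons.prems(1,2) that by (cases g) (auto simp: eq)
  then show ?case using Cons.prems by (simp add: Cons.IH)
qed simp

text \<open>At \<open>- pi / 4\<close> the cosine is \<open>1 / sqrt 2\<close> and the sine its
  negative. With \<open>b\<close> already turned into \<open>- (\<omega> ^ k) * b\<close>, wire
  \<open>i\<close> receives the sum and wire \<open>j\<close> the difference.\<close>

lemma fold_gate_act_butterfly_gates:
  assumes "i \<noteq> j"
  shows "fold gate_act (butterfly_gates \<omega> (i, j, k)) = butterfly_map (radix2_sum \<omega>) (radix2_diff \<omega>) (i, j, k)"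
proof -
  have "sqrt 2 / 2 = 1 / sqrt 2" by (simp add: field_simps)
  then have "cos (pi / 4) = 1 / sqrt 2" "sin (pi / 4) = 1 / sqrt 2"
    by (simp_all add: cos_45 sin_45)
  then show ?thesis
    using assms
    by (simp add: fun_eq_iff radix2_sum_def radix2_diff_def add_divide_distrib diff_divide_distrib)
qed

lemma fold_gate_act_unary_qft:
  "fold gate_act (unary_qft m) =
    fold (butterfly_map (radix2_sum (omega (2 ^ m))) (radix2_diff (omega (2 ^ m)))) (fft_diagram m 0 1)"
proof
  fix v
  show "fold gate_act (unary_qft m) v =
    fold (butterfly_map (radix2_sum (omega (2 ^ m))) (radix2_diff (omega (2 ^ m)))) (fft_diagram m 0 1) v"
    unfolding unary_qft_def fold_concat_map
  proof (rule List.fold_cong[OF refl refl])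
    fix b assume b: "b \<in> set (fft_diagram m 0 1)"
    obtain i j k where ijk: "b = (i, j, k)" by (cases b)
    with b have "i \<noteq> j" using fft_diagram_wires[of i j k] by blast
    then show "fold gate_act (butterfly_gates (omega (2 ^ m)) b) =
        butterfly_map (radix2_sum (omega (2 ^ m))) (radix2_diff (omega (2 ^ m))) b"
      unfolding ijk by (rule fold_gate_act_butterfly_gates)
  qed
qed

lemma Phase_0_notin_unary_qft: "Phase q 0 \<notin> set (unary_qft m)"
  by (auto simp: unary_qft_def omega_nonzero)

lemma radix2_gates_implement:
  "implements (circuit_mat 2 (butterfly_gates \<omega> (0, 1, k)))
     [ket [False, True], ket [True, False]] [ket [False, True], ket [True, False]]
     (complex_of_real (1 / sqrt 2) \<cdot>\<^sub>m radix2_mat \<omega> k)" (is "implements ?M _ _ ?A")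
proof -
  have A: "?A \<in> carrier_mat 2 2" by (simp add: radix2_mat_def mat_of_rows_list_def numeral_2_eq_2)
  have id: "bij_betw id {..<2} {..<2 :: nat}" by simp
  have valid: "\<forall>g\<in>set (butterfly_gates \<omega> (0, 1, k)). valid_gate 2 g" by simp
  have "?M *\<^sub>v unary_state 2 id x = unary_state 2 id (?A *\<^sub>v x)" if x: "x \<in> carrier_vec 2" for x
  proof -
    have "?M *\<^sub>v unary_state 2 id x = ?M *\<^sub>v unary_vec 2 (\<lambda>i. x $ i)"
      by (simp add: unary_state_eq[OF id, of "\<lambda>i. x $ i"])
    also have "\<dots> = unary_vec 2 (butterfly_map (radix2_sum \<omega>) (radix2_diff \<omega>) (0, 1, k) (\<lambda>i. x $ i))"
      unfolding circuit_mat_mult_unary_vec[OF valid] fold_gate_act_butterfly_gates[OF zero_neq_one] ..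
    also have "\<dots> = unary_state 2 id (?A *\<^sub>v x)"
    proof (rule unary_state_eq[OF id, symmetric])
      fix i :: nat assume "i < 2"
      then consider "i = 0" | "i = 1" by linarith
      then show "butterfly_map (radix2_sum \<omega>) (radix2_diff \<omega>) (0, 1, k) (\<lambda>i. x $ i) (id i) = (?A *\<^sub>v x) $ i"
        using x by cases (simp_all add: radix2_sum_def radix2_diff_def radix2_mat_def mat_of_rows_list_def
            scalar_prod_def numeral_2_eq_2 add_divide_distrib diff_divide_distrib)
    qed
    finally show ?thesis .
  qed
  then have "implements ?M (map (\<lambda>i. unary_ket 2 (id i)) [0..<2]) (map (\<lambda>i. unary_ket 2 (id i)) [0..<2]) ?A"
    by (rule implementsI[OF circuit_mat_carrier A id id])
  \<comment> \<open>\<open>|01>\<close> excites qubit 0, the wire of \<open>a\<close>, so the order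
    of the basis is that of the wires.\<close>
  moreover have "map (\<lambda>i. unary_ket 2 (id i)) [0..<2] = [ket [False, True], ket [True, False]]"
    by (simp add: unary_ket_def numeral_2_eq_2)
  ultimately show ?thesis by (simp only:)
qed

section \<open>Correctness of the circuit and its inverse on \<open>2 ^ m\<close> qubits\<close>

context
  fixes m n :: nat
  assumes n: "n = 2 ^ m"
begin

text \<open>Bit reversal is its own inverse, so it appears again in the amplitudes.\<close>

lemma unary_state_bit_reversal:
  "unary_state n (bit_reversal m) x = unary_vec n (\<lambda>i. x $ bit_reversal m i)"
  using bij_betw_bit_reversal[of m] by (intro unary_state_eq) (auto simp: n bit_reversal_involution)

lemma unary_state_id: "unary_state n id x = unary_vec n (\<lambda>i. x $ i)"
  by (intro unary_state_eq) auto

lemma unary_qft_amplitudes: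
  assumes "x \<in> carrier_vec n" "j < n"
  shows "fold gate_act (unary_qft m) (\<lambda>i. x $ bit_reversal m i) j = (scaled_fourier_mat n *\<^sub>v x) $ j"
proof -
  have "fold gate_act (unary_qft m) (\<lambda>i. x $ bit_reversal m i) (0 + j) =
      (\<Sum>i<n. omega n ^ (j * i) * x $ bit_reversal m (0 + bit_reversal m i)) / complex_of_real (sqrt 2) ^ m"
    unfolding fold_gate_act_unary_qft n using assms(2)
    by (intro fold_fft_diagram_eq_dft) (simp_all add: n)
  \<comment> \<open>The reversal of the loaded data cancels that of the diagram, and the
    \<open>m\<close> factors \<open>sqrt 2\<close> combine to \<open>sqrt n\<close>.\<close>
  also have "\<dots> = (\<Sum>i<n. omega n ^ (j * i) * x $ i) / complex_of_real (sqrt n)"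
    by (simp add: n bit_reversal_involution real_sqrt_power)
  finally show ?thesis using scaled_fourier_mat_mult_index[OF assms] by simp
qed

lemma unary_state_scaled_fourier_mat:
  assumes "x \<in> carrier_vec n"
  shows "unary_state n id (scaled_fourier_mat n *\<^sub>v x) =
    unary_vec n (fold gate_act (unary_qft m) (\<lambda>i. x $ bit_reversal m i))"
  unfolding unary_state_id using assms by (intro unary_vec_cong) (simp add: unary_qft_amplitudes)

lemma unary_qft_correct:
  assumes "x \<in> carrier_vec n"
  shows "circuit_mat n (unary_qft m) *\<^sub>v unary_state n (bit_reversal m) x =
    unary_state n id (scaled_fourier_mat n *\<^sub>v x)"
  unfolding unary_state_bit_reversal unary_state_scaled_fourier_mat[OF assms]
  by (rule circuit_mat_mult_unary_vec) (simp add: n valid_gate_unary_qft)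

lemma valid_gate_inverse_unary_qft: "\<forall>g\<in>set (inverse_circuit (unary_qft m)). valid_gate n g"
  using valid_gate_inverse_circuit valid_gate_unary_qft unfolding n by blast

lemma inverse_unary_qft_amplitudes:
  "fold gate_act (inverse_circuit (unary_qft m)) (fold gate_act (unary_qft m) v) = v"
  using valid_gate_unary_qft Phase_0_notin_unary_qft by (intro fold_gate_act_inverse_circuit) blast+

lemma inverse_unary_qft_correct:
  assumes "x \<in> carrier_vec n"
  shows "circuit_mat n (inverse_circuit (unary_qft m)) *\<^sub>v
    unary_state n id (scaled_fourier_mat n *\<^sub>v x) = unary_state n (bit_reversal m) x"
  unfolding unary_state_bit_reversal unary_state_scaled_fourier_mat[OF assms]
    circuit_mat_mult_unary_vec[OF valid_gate_inverse_unary_qft] inverse_unary_qft_amplitudes ..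

text \<open>The inverse circuit leaves \<open>x $ \<sigma> j\<close> on qubit \<open>j\<close>;
  after relabelling this value sits on qubit \<open>\<sigma> j\<close>, where it belongs, while the
  input is read in reversed order.\<close>

lemma relabelled_inverse_unary_qft_correct:
  assumes "x \<in> carrier_vec n"
  shows "circuit_mat n (map (relabel_gate (bit_reversal m)) (inverse_circuit (unary_qft m))) *\<^sub>v
    unary_state n (bit_reversal m) (scaled_fourier_mat n *\<^sub>v x) = unary_state n id x"
proof -
  let ?\<sigma> = "bit_reversal m" and ?IC = "inverse_circuit (unary_qft m)"
  define y where "y = scaled_fourier_mat n *\<^sub>v x"
  have inj: "inj_on ?\<sigma> {..<n}" and img: "?\<sigma> ` {..<n} \<subseteq> {..<n}"
    using bij_betw_bit_reversal[of m] by (auto simp: n bij_betw_def)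
  have "\<forall>g\<in>set (map (relabel_gate ?\<sigma>) ?IC). valid_gate n g"
    using valid_gate_inverse_unary_qft valid_gate_relabel_gate[OF inj img] by auto
  then have "circuit_mat n (map (relabel_gate ?\<sigma>) ?IC) *\<^sub>v unary_state n ?\<sigma> y =
      unary_vec n (fold gate_act (map (relabel_gate ?\<sigma>) ?IC) (\<lambda>i. y $ ?\<sigma> i))"
    unfolding unary_state_bit_reversal by (rule circuit_mat_mult_unary_vec)
  also have "\<dots> = unary_vec n (\<lambda>i. x $ i)"
  proof (rule unary_vec_cong)
    fix i assume i: "i < n"
    then have i': "?\<sigma> i < n" "?\<sigma> (?\<sigma> i) = i" by (auto simp: n bit_reversal_less bit_reversal_involution)
    \<comment> \<open>Writing qubit \<open>i\<close> as \<open>?\<sigma> (?\<sigma> i)\<close>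
      presents it as the relabelling of \<open>?\<sigma> i\<close>.\<close>
    have "fold gate_act (map (relabel_gate ?\<sigma>) ?IC) (\<lambda>i. y $ ?\<sigma> i) (?\<sigma> (?\<sigma> i)) =
        fold gate_act ?IC (fold gate_act (unary_qft m) (\<lambda>i. x $ ?\<sigma> i)) (?\<sigma> i)"
      using i' assms inj valid_gate_inverse_unary_qft
      by (intro fold_gate_act_relabel)
         (auto simp: n y_def bit_reversal_involution unary_qft_amplitudes[unfolded n])
    then show "fold gate_act (map (relabel_gate ?\<sigma>) ?IC) (\<lambda>i. y $ ?\<sigma> i) i = x $ i"
      unfolding inverse_unary_qft_amplitudes i'(2) .
  qed
  finally show ?thesis unfolding y_def unary_state_id .
qed

end

theorem mainTheorem1:
  fixes m n :: nat
  assumes n: "n = 2 ^ m"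
  shows
   "let C = unary_qft m;
        \<sigma> = bit_reversal m;
        F = scaled_fourier_mat n;
        basis = map (unary_ket n) [0..<n];
        permuted_basis = map (\<lambda>i. unary_ket n (\<sigma> i)) [0..<n];
        normalised = (\<lambda>x :: real vec. x \<in> carrier_vec n \<and> (\<Sum>i<n. (x $ i)\<^sup>2) = 1);
        xc = (\<lambda>x :: real vec. map_vec complex_of_real x);
        xhat = (\<lambda>x :: real vec. F *\<^sub>v map_vec complex_of_real x);
        IC = inverse_circuit C
    in
      (\<forall>k :: nat.
         implements (circuit_mat 2 (butterfly_gates (omega n) (0, 1, k)))
           [ket [False, True], ket [True, False]] [ket [False, True], ket [True, False]]
           (complex_of_real (1 / sqrt 2) \<cdot>\<^sub>m radix2_mat (omega n) k)) \<and>
      bij_betw \<sigma> {..<n} {..<n} \<and>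
      unitary_mat F \<and>
      implements (circuit_mat n C) permuted_basis basis F \<and>
      (\<forall>x. normalised x \<longrightarrow>
         circuit_mat n C *\<^sub>v unary_state n \<sigma> (xc x) = unary_state n id (xhat x)) \<and>
      (\<forall>g\<in>set C. valid_gate n g) \<and>
      (2 \<le> n \<longrightarrow> (\<Union>g\<in>set C. gate_qubits g) = {..<n}) \<and>
      real (length C) = real n * log 2 (real n) \<and>
      \<comment> \<open>depth counted in radix-2 operations, then in elementary gates\<close>
      real (depth (map butterfly_wires (fft_diagram m 0 1))) = log 2 (real n) \<and>
      real (depth (map gate_qubits C)) = 2 * log 2 (real n) \<and>
      \<comment> \<open>the inverse circuit returns the data in the permuted order in which they were loaded; with its
          qubits relabelled, it takes its input in that order instead\<close>
      implements (circuit_mat n IC) basis permuted_basis (mat_adjoint F) \<and>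
      (\<forall>x. normalised x \<longrightarrow>
         circuit_mat n IC *\<^sub>v unary_state n id (xhat x) = unary_state n \<sigma> (xc x)) \<and>
      (\<forall>x. normalised x \<longrightarrow>
         circuit_mat n (map (relabel_gate \<sigma>) IC) *\<^sub>v unary_state n \<sigma> (xhat x)
           = unary_state n id (xc x))"
proof -
  define F where "F = scaled_fourier_mat n"
  have F: "F \<in> carrier_mat n n" unfolding F_def by (rule scaled_fourier_mat_carrier)
  note F' = mat_adjoint_carrier[OF F]
  have bij: "bij_betw (bit_reversal m) {..<n} {..<n}" unfolding n by (rule bij_betw_bit_reversal)
  have id: "bij_betw id {..<n} {..<n}" by simp
  have log: "log 2 (real n) = real m" by (simp add: n)
  have unitary: "unitary_mat F" unfolding F_def by (rule unitary_scaled_fourier_mat) (simp add: n)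
  then have FF': "F * mat_adjoint F = 1\<^sub>m n" using F by (simp add: unitary_mat_def inverts_mat_def)
  have qft: "implements (circuit_mat n (unary_qft m)) (map (\<lambda>i. unary_ket n (bit_reversal m i)) [0..<n])
      (map (\<lambda>i. unary_ket n (id i)) [0..<n]) F"
    by (rule implementsI[OF circuit_mat_carrier F bij id]) (simp add: F_def unary_qft_correct[OF n])
  have "circuit_mat n (inverse_circuit (unary_qft m)) *\<^sub>v unary_state n id y =
      unary_state n (bit_reversal m) (mat_adjoint F *\<^sub>v y)" if y: "y \<in> carrier_vec n" for y
  proof -
    \<comment> \<open>Every \<open>y\<close> is the transform of
      \<open>mat_adjoint F *\<^sub>v y\<close>, so correctness on transforms covers all
      inputs.\<close>
    have "F *\<^sub>v (mat_adjoint F *\<^sub>v y) = y"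
      using assoc_mult_mat_vec[OF F F' y] FF' y by simp
    then show ?thesis
      using inverse_unary_qft_correct[OF n mult_mat_vec_carrier[OF F' y]] by (simp add: F_def)
  qed
  then have iqft: "implements (circuit_mat n (inverse_circuit (unary_qft m)))
      (map (\<lambda>i. unary_ket n (id i)) [0..<n]) (map (\<lambda>i. unary_ket n (bit_reversal m i)) [0..<n])
      (mat_adjoint F)"
    by (intro implementsI[OF circuit_mat_carrier F' id bij])
  \<comment> \<open>For \<open>n = 1\<close> the circuit is empty; \<open>2 \<le> n\<close> means
    \<open>0 < m\<close>.\<close>
  have gates: "(\<Union>g\<in>set (unary_qft m). gate_qubits g) = {..<n}" if "2 \<le> n"
    using that Union_gate_qubits_unary_qft[of m] by (cases m) (auto simp: n)
  show ?thesis
    unfolding Let_def F_def[symmetric]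
    using radix2_gates_implement bij unitary qft iqft valid_gate_unary_qft[of _ m, folded n] gates
      unary_qft_correct[OF n, folded F_def] inverse_unary_qft_correct[OF n, folded F_def]
      relabelled_inverse_unary_qft_correct[OF n, folded F_def]
    by (simp add: log length_unary_qft depth_fft_diagram depth_unary_qft n)
qed

end
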